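(* Let $a>0$, $d>0$, let $N$ be a positive even integer, $h=2\pi/N$, and $\tau>0$. Consider the central scheme $$\frac{\mathrm d u_{j}}{\mathrm d t} + a\,\frac{u_{j+1}-u_{j-1}}{2h} = d\,\frac{u_{j+1}-2u_{j}+u_{j-1}}{h^2},\qquad u_{j+N}=u_j,$$ for the periodic advection-diffusion equation $u_t+au_x=du_{xx}$, discretized in time by the ETD-RK1 method with time step $\tau$. This fully discrete scheme is stable under the time-step constraint $\tau\le 2\frac{d}{a^2}$.
   Context: Write the semidiscrete scheme as $\mathbf u_t=D\mathbf u-A\mathbf u$, where $(D\mathbf u)_j=d\,\frac{u_{j+1}-2u_j+u_{j-1}}{h^2}$ and $(A\mathbf u)_j=a\,\frac{u_{j+1}-u_{j-1}}{2h}$ act on $N$-periodic complex grid functions. The ETD-RK1 method is $$\mathbf{u}^{n+1}=e^{\tau D}\mathbf{u}^n-D^{-1}\left(e^{\tau D}-I\right)A\mathbf{u}^n,$$ where $D^{-1}(e^{\tau D}-I)$ denotes $\tau\varphi_1(\tau D)$, with $\varphi_1(z)=(e^z-1)/z$, $\varphi_1(0)=1$. Stability: for each integer $\omega\in\{-\frac N2+1,\dots,\frac N2\}$, the Fourier mode $u^n_j=\widehat u^n e^{\mathrm i\omega jh}$ is a common eigenvector of $D$ and $A$, so the scheme multiplies it by a scalar growth factor $\widehat G$. The scheme is called stable if $|\widehat G|\le 1$ for all such $\omega$. *)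

theory Defs
  imports "HOL-Complex_Analysis.Complex_Analysis"
begin

type_synonym grid_fun = "int \<Rightarrow> complex"

definition grid_periodic :: "nat \<Rightarrow> grid_fun \<Rightarrow> bool" where
  "grid_periodic N u \<longleftrightarrow> (\<forall>j. u (j + int N) = u j)"

definition D_op :: "real \<Rightarrow> real \<Rightarrow> grid_fun \<Rightarrow> grid_fun" where
  "D_op d h u = (\<lambda>j. of_real d * ((u (j + 1) - 2 * u j + u (j - 1)) / of_real (h\<^sup>2)))"

definition A_op :: "real \<Rightarrow> real \<Rightarrow> grid_fun \<Rightarrow> grid_fun" where
  "A_op a h u = (\<lambda>j. of_real a * ((u (j + 1) - u (j - 1)) / of_real (2 * h)))"

definition scale_op :: "real \<Rightarrow> (grid_fun \<Rightarrow> grid_fun) \<Rightarrow> grid_fun \<Rightarrow> grid_fun" where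
  "scale_op \<tau> T u = (\<lambda>j. of_real \<tau> * T u j)"

text \<open>
  The operator function \<open>f(T) = (\<Sum>k. c\<^sub>k T\<^sup>k)\<close>, where \<open>c\<^sub>k\<close> are the Taylor coefficients of
  \<open>f\<close> at \<open>0\<close>. It is meant for entire \<open>f\<close>; the operators \<open>T\<close> used below are linear maps on the
  finite-dimensional space of \<open>N\<close>-periodic grid functions, where the series converges at every
  grid point.
\<close>
definition op_fun ::
    "(complex \<Rightarrow> complex) \<Rightarrow> (grid_fun \<Rightarrow> grid_fun) \<Rightarrow> grid_fun \<Rightarrow> grid_fun" where
  "op_fun f T u = (\<lambda>j. \<Sum>k. fps_nth (fps_expansion f 0) k * (T ^^ k) u j)"

definition phi1 :: "complex \<Rightarrow> complex" where
  "phi1 z = (if z = 0 then 1 else (exp z - 1) / z)"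

text \<open>
  One step of ETD-RK1. The operator \<open>D\<close> is singular (it annihilates constants), so
  \<open>D\<^sup>-\<^sup>1 (e\<^bsup>\<tau>D\<^esup> - I)\<close> is read as \<open>\<tau> \<phi>\<^sub>1(\<tau>D)\<close>.
\<close>
definition etd_rk1_step ::
    "real \<Rightarrow> (grid_fun \<Rightarrow> grid_fun) \<Rightarrow> (grid_fun \<Rightarrow> grid_fun) \<Rightarrow> grid_fun \<Rightarrow> grid_fun" where
  "etd_rk1_step \<tau> D A u =
     (\<lambda>j. op_fun exp (scale_op \<tau> D) u j - of_real \<tau> * op_fun phi1 (scale_op \<tau> D) (A u) j)"

definition fourier_mode :: "real \<Rightarrow> int \<Rightarrow> grid_fun" where
  "fourier_mode h \<omega> = (\<lambda>j. exp (\<i> * of_real (of_int \<omega> * of_int j * h)))"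

text \<open>\<open>G\<close> is unique when it exists, as Fourier modes do not vanish.\<close>
definition is_growth_factor ::
    "(grid_fun \<Rightarrow> grid_fun) \<Rightarrow> real \<Rightarrow> int \<Rightarrow> complex \<Rightarrow> bool" where
  "is_growth_factor S h \<omega> G \<longleftrightarrow>
     (\<forall>c :: complex. S (\<lambda>j. c * fourier_mode h \<omega> j) = (\<lambda>j. G * (c * fourier_mode h \<omega> j)))"

definition scheme_stable :: "nat \<Rightarrow> real \<Rightarrow> (grid_fun \<Rightarrow> grid_fun) \<Rightarrow> bool" where
  "scheme_stable N h S \<longleftrightarrow>
     (\<forall>\<omega> \<in> {- (int N div 2) + 1 .. int N div 2}.
        \<exists>G. is_growth_factor S h \<omega> G \<and> cmod G \<le> 1)"

lemma is_growth_factor_unique: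
  assumes "is_growth_factor S h \<omega> G" "is_growth_factor S h \<omega> G'"
  shows "G = G'"
proof -
  have "(\<lambda>j. G * (1 * fourier_mode h \<omega> j)) = (\<lambda>j. G' * (1 * fourier_mode h \<omega> j))"
    using assms unfolding is_growth_factor_def by metis
  from fun_cong[OF this, of 0] show ?thesis
    by (simp add: fourier_mode_def)
qed

lemma grid_periodic_fourier_mode:
  assumes "N > 0" "h = 2 * pi / real N"
  shows "grid_periodic N (fourier_mode h \<omega>)"
proof -
  have "real N * h = 2 * pi"
    using assms by simp
  then have Nh: "of_nat N * of_real h = (2 * of_real pi :: complex)"
    by (metis of_real_mult of_real_numeral of_real_of_nat_eq)
  have "fourier_mode h \<omega> (j + int N) = fourier_mode h \<omega> j" for j
  proof -
    have "\<i> * of_real (of_int \<omega> * of_int (j + int N) * h)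
        = \<i> * of_real (of_int \<omega> * of_int j * h) + 2 * of_int \<omega> * of_real pi * \<i>"
      using Nh by (simp add: algebra_simps)
    then show ?thesis
      unfolding fourier_mode_def by (simp add: exp_add exp_integer_2pi mult_ac)
  qed
  then show ?thesis by (simp add: grid_periodic_def)
qed

lemma grid_periodic_shift:
  assumes "grid_periodic N u"
  shows "u (j + int N + k) = u (j + k)" "u (j + int N - k) = u (j - k)"
  using spec[OF assms[unfolded grid_periodic_def], of "j + k"]
    spec[OF assms[unfolded grid_periodic_def], of "j - k"]
  by (simp_all add: algebra_simps)

lemma grid_periodic_D_op:
  assumes "grid_periodic N u"
  shows "grid_periodic N (D_op d h u)"
  using grid_periodic_shift[OF assms, where k = 1] grid_periodic_shift[OF assms, where k = 0]
  by (simp add: grid_periodic_def D_op_def)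

lemma grid_periodic_A_op:
  assumes "grid_periodic N u"
  shows "grid_periodic N (A_op a h u)"
  using grid_periodic_shift[OF assms, where k = 1]
  by (simp add: grid_periodic_def A_op_def)

lemma grid_periodic_op_fun:
  assumes T: "\<And>v. grid_periodic N v \<Longrightarrow> grid_periodic N (T v)" and u: "grid_periodic N u"
  shows "grid_periodic N (op_fun f T u)"
proof -
  have "grid_periodic N ((T ^^ k) u)" for k
    by (induction k) (use T u in auto)
  then show ?thesis by (simp add: grid_periodic_def op_fun_def)
qed

lemma grid_periodic_etd_rk1_step:
  assumes "grid_periodic N u"
  shows "grid_periodic N (etd_rk1_step \<tau> (D_op d h) (A_op a h) u)"
proof -
  have T: "grid_periodic N (scale_op \<tau> (D_op d h) v)" if "grid_periodic N v" for v
    using grid_periodic_D_op[OF that, of d h] by (simp add: grid_periodic_def scale_op_def)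
  have "grid_periodic N (op_fun exp (scale_op \<tau> (D_op d h)) u)"
       "grid_periodic N (op_fun phi1 (scale_op \<tau> (D_op d h)) (A_op a h u))"
    using T assms by (auto intro!: grid_periodic_op_fun grid_periodic_A_op)
  then show ?thesis by (simp add: grid_periodic_def etd_rk1_step_def)
qed

lemma op_fun_eigenvector:
  assumes f: "f holomorphic_on UNIV" and T: "\<And>c. T (\<lambda>j. c * u j) = (\<lambda>j. c * (z * u j))"
  shows "op_fun f T u = (\<lambda>j. f z * u j)"
proof
  fix j
  have pow: "(T ^^ k) u = (\<lambda>j. z ^ k * u j)" for k
    by (induction k) (simp_all add: T mult.assoc mult.left_commute)
  have "(\<lambda>k. (deriv ^^ k) f 0 / fact k * (z - 0) ^ k) sums f z"
    by (rule holomorphic_power_series[where r = "norm z + 1"])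
       (auto intro: holomorphic_on_subset[OF f])
  from sums_mult2[OF this, of "u j"]
  have "(\<lambda>k. fps_nth (fps_expansion f 0) k * (T ^^ k) u j) sums (f z * u j)"
    by (simp add: fps_expansion_def pow mult_ac)
  then show "op_fun f T u j = f z * u j"
    by (simp add: op_fun_def sums_iff)
qed

end

theory Submission
  imports Defs
begin

text \<open>
  With \<open>\<theta> = \<omega>h\<close> and \<open>x = 4\<tau>d sin\<^sup>2(\<theta>/2)/h\<^sup>2\<close>, the growth factor is
  \<open>e\<^bsup>-x\<^esup> - \<i>\<tau>a (sin \<theta>/h) (1 - e\<^bsup>-x\<^esup>)/x\<close>. As \<open>sin\<^sup>2 \<theta> \<le> 4 sin\<^sup>2(\<theta>/2)\<close>,
  the constraint on \<open>\<tau>\<close> bounds \<open>(\<tau>a sin \<theta>/h)\<^sup>2\<close> by \<open>2x\<close>, and the squared modulus is at most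
  \<open>1\<close> because \<open>2(1 - e\<^bsup>-x\<^esup>)/(1 + e\<^bsup>-x\<^esup>) = 2 tanh(x/2) \<le> x\<close>.
\<close>

text \<open>The singularity at 0 is removable: \<open>phi1\<close> is the difference quotient of
  \<open>exp\<close> at 0, completed there by the derivative. Being entire is what lets
  \<open>op_fun_eigenvector\<close> evaluate its Taylor series on an eigenvector.\<close>

lemma phi1_holomorphic: "phi1 holomorphic_on UNIV"
proof -
  have "(\<lambda>z::complex. if z = 0 then deriv exp 0 else (exp z - exp 0) / (z - 0)) holomorphic_on UNIV"
    by (rule pole_lemma) (auto intro: holomorphic_intros)
  then show ?thesis
    using DERIV_imp_deriv[OF DERIV_exp[of "0 :: complex"]] by (simp add: phi1_def[abs_def] cong: if_cong)
qed

lemma phi1_of_real: "phi1 (of_real x) = of_real (if x = 0 then 1 else (exp x - 1) / x)"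
  by (simp add: phi1_def exp_of_real)

lemma fourier_mode_shift:
  "fourier_mode h \<omega> (j + 1) = cis (of_int \<omega> * h) * fourier_mode h \<omega> j"
  "fourier_mode h \<omega> (j - 1) = cis (- (of_int \<omega> * h)) * fourier_mode h \<omega> j"
  by (simp_all add: fourier_mode_def cis_conv_exp algebra_simps flip: exp_add)

lemma D_op_fourier_mode:
  "D_op d h (\<lambda>j. c * fourier_mode h \<omega> j) =
     (\<lambda>j. c * (of_real (- 4 * d * (sin (of_int \<omega> * h / 2))\<^sup>2 / h\<^sup>2) * fourier_mode h \<omega> j))"
proof
  fix j
  \<comment> \<open>Half-angle form of the symbol: 2 cos \<theta> - 2 = -4 (sin
    (\<theta>/2))^2.\<close>
  have "cis \<theta> - 2 + cis (- \<theta>) = of_real (- 4 * (sin (\<theta> / 2))\<^sup>2)" for \<theta>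
    using cos_double_sin[of "\<theta> / 2"] by (simp add: complex_eq_iff)
  note cis = this[of "of_int \<omega> * h"]
  have "c * fourier_mode h \<omega> (j + 1) - 2 * (c * fourier_mode h \<omega> j) + c * fourier_mode h \<omega> (j - 1)
      = c * fourier_mode h \<omega> j * (cis (of_int \<omega> * h) - 2 + cis (- (of_int \<omega> * h)))"
    unfolding fourier_mode_shift by (simp only: algebra_simps)
  note this[unfolded cis]
  then show "D_op d h (\<lambda>j. c * fourier_mode h \<omega> j) j =
     c * (of_real (- 4 * d * (sin (of_int \<omega> * h / 2))\<^sup>2 / h\<^sup>2) * fourier_mode h \<omega> j)"
    by (simp add: D_op_def)
qed

lemma A_op_fourier_mode:
  "A_op a h (\<lambda>j. c * fourier_mode h \<omega> j) =
     (\<lambda>j. \<i> * of_real (a * sin (of_int \<omega> * h) / h) * (c * fourier_mode h \<omega> j))"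
proof
  fix j
  have "cis \<theta> - cis (- \<theta>) = 2 * \<i> * of_real (sin \<theta>)" for \<theta>
    by (simp add: complex_eq_iff)
  note cis = this[of "of_int \<omega> * h"]
  have "c * fourier_mode h \<omega> (j + 1) - c * fourier_mode h \<omega> (j - 1)
      = c * fourier_mode h \<omega> j * (cis (of_int \<omega> * h) - cis (- (of_int \<omega> * h)))"
    unfolding fourier_mode_shift by (simp only: algebra_simps)
  note this[unfolded cis]
  then show "A_op a h (\<lambda>j. c * fourier_mode h \<omega> j) j =
     \<i> * of_real (a * sin (of_int \<omega> * h) / h) * (c * fourier_mode h \<omega> j)"
    by (simp add: A_op_def)
qed

lemma etd_rk1_growth_factor:
  fixes a d h \<tau> :: real and \<omega> :: int
  defines "x \<equiv> \<tau> * (4 * d * (sin (of_int \<omega> * h / 2))\<^sup>2 / h\<^sup>2)"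
  shows "is_growth_factor (etd_rk1_step \<tau> (D_op d h) (A_op a h)) h \<omega>
    (exp (of_real (- x)) - \<i> * of_real (\<tau> * (a * sin (of_int \<omega> * h) / h)) * phi1 (of_real (- x)))"
  unfolding is_growth_factor_def
proof
  fix c
  let ?m = "\<i> * of_real (a * sin (of_int \<omega> * h) / h) :: complex"
  \<comment> \<open>The inner scalar \<open>b\<close> makes one fact serve both uses below: the mode
    times \<open>c\<close>, and its image under \<open>A_op\<close>, the mode times
    \<open>?m * c\<close>. The outer scalar \<open>c'\<close> is the homogeneity that
    \<open>op_fun_eigenvector\<close> asks for.\<close>
  have T: "scale_op \<tau> (D_op d h) (\<lambda>j. c' * (b * fourier_mode h \<omega> j)) =
      (\<lambda>j. c' * (of_real (- x) * (b * fourier_mode h \<omega> j)))" for b c' :: complex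
    using D_op_fourier_mode[of d h "c' * b" \<omega>]
    by (simp add: scale_op_def x_def mult_ac)
  have 1: "op_fun exp (scale_op \<tau> (D_op d h)) (\<lambda>j. c * fourier_mode h \<omega> j)
      = (\<lambda>j. exp (of_real (- x)) * (c * fourier_mode h \<omega> j))"
    by (rule op_fun_eigenvector[OF holomorphic_on_exp T])
  have 2: "op_fun phi1 (scale_op \<tau> (D_op d h)) (\<lambda>j. (?m * c) * fourier_mode h \<omega> j)
      = (\<lambda>j. phi1 (of_real (- x)) * ((?m * c) * fourier_mode h \<omega> j))"
    by (rule op_fun_eigenvector[OF phi1_holomorphic T])
  show "etd_rk1_step \<tau> (D_op d h) (A_op a h) (\<lambda>j. c * fourier_mode h \<omega> j) =
     (\<lambda>j. (exp (of_real (- x)) - \<i> * of_real (\<tau> * (a * sin (of_int \<omega> * h) / h)) * phi1 (of_real (- x)))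
        * (c * fourier_mode h \<omega> j))"
    unfolding etd_rk1_step_def A_op_fourier_mode 1 2[unfolded mult.assoc] mult.assoc
    by (simp add: algebra_simps)
qed

text \<open>The difference of the two sides vanishes at 0 and has derivative 1 - exp(-t) (1 + t),
  which is nonnegative because 1 + t \<le> exp t.\<close>

lemma two_one_minus_exp_le:
  fixes x :: real
  assumes "x \<ge> 0"
  shows "2 * (1 - exp (- x)) \<le> x * (1 + exp (- x))"
proof -
  let ?f = "\<lambda>x::real. x * (1 + exp (- x)) - 2 * (1 - exp (- x))"
  have "?f 0 \<le> ?f x"
  proof (rule DERIV_nonneg_imp_nondecreasing[OF assms])
    fix t :: real
    have "(?f has_real_derivative 1 - exp (- t) * (1 + t)) (at t)"
      by (auto intro!: derivative_eq_intros simp: algebra_simps)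
    moreover have "exp (- t) * (1 + t) \<le> exp (- t) * exp t"
      by (intro mult_left_mono exp_ge_add_one_self) simp
    then have "0 \<le> 1 - exp (- t) * (1 + t)"
      by (simp flip: exp_add)
    ultimately show "\<exists>y. (?f has_real_derivative y) (at t) \<and> 0 \<le> y" by blast
  qed
  then show ?thesis by simp
qed

lemma norm_growth_le_1:
  fixes x q :: real
  assumes "x \<ge> 0" and q: "q\<^sup>2 \<le> 2 * x"
  shows "cmod (exp (of_real (- x)) - \<i> * of_real q * phi1 (of_real (- x))) \<le> 1"
proof (cases "x = 0")
  case True
  \<comment> \<open>Here \<open>q\<close> must vanish, so the factor is exactly 1.\<close>
  then show ?thesis using q by (simp add: phi1_def)
next
  case False
  then have x: "x > 0" using assms by simp
  define E where "E = exp (- x)"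
  have E: "0 < E" "E < 1" using x by (auto simp: E_def)
  \<comment> \<open>Since phi1(-x) = (1 - E)/x is real, the two terms are the real and imaginary
    parts.\<close>
  have "exp (of_real (- x)) - \<i> * of_real q * phi1 (of_real (- x)) = Complex E (- (q * ((1 - E) / x)))"
    unfolding phi1_of_real exp_of_real using x by (simp add: complex_eq_iff E_def field_simps)
  moreover have "E\<^sup>2 + (- (q * ((1 - E) / x)))\<^sup>2 \<le> 1"
  proof -
    have "(- (q * ((1 - E) / x)))\<^sup>2 = q\<^sup>2 * ((1 - E) / x)\<^sup>2"
      by (simp only: power2_minus power_mult_distrib)
    also have "\<dots> \<le> (2 * x) * ((1 - E) / x)\<^sup>2"
      by (rule mult_right_mono[OF q]) simp
    also have "\<dots> = (1 - E) * (2 * (1 - E)) / x"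
      using x by (simp add: power2_eq_square)
    \<comment> \<open>Only one factor 1 - E is estimated; the other is kept, so that x cancels and
      (1 - E)(1 + E) remains.\<close>
    also have "\<dots> \<le> (1 - E) * (x * (1 + E)) / x"
      using two_one_minus_exp_le[of x] x E
      by (intro divide_right_mono mult_left_mono) (auto simp: E_def)
    also have "\<dots> = 1 - E\<^sup>2"
      using x by (simp add: field_simps power2_eq_square)
    finally show ?thesis by simp
  qed
  ultimately show ?thesis by (simp add: cmod_def)
qed

theorem corollary3p1:
  fixes a d h \<tau> :: real and N :: nat
  assumes "a > 0" and "d > 0"
    and "N > 0" and "even N"
    and "h = 2 * pi / real N"
    and "\<tau> > 0"
    and "\<tau> \<le> 2 * (d / a\<^sup>2)"
  shows "scheme_stable N h (etd_rk1_step \<tau> (D_op d h) (A_op a h))"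
  unfolding scheme_stable_def
proof (intro ballI exI conjI)
  fix \<omega>
  show "is_growth_factor (etd_rk1_step \<tau> (D_op d h) (A_op a h)) h \<omega>
      (exp (of_real (- (\<tau> * (4 * d * (sin (of_int \<omega> * h / 2))\<^sup>2 / h\<^sup>2))))
       - \<i> * of_real (\<tau> * (a * sin (of_int \<omega> * h) / h))
         * phi1 (of_real (- (\<tau> * (4 * d * (sin (of_int \<omega> * h / 2))\<^sup>2 / h\<^sup>2)))))"
    by (rule etd_rk1_growth_factor)
  define s where "s = sin (of_int \<omega> * h / 2)"
  define c where "c = cos (of_int \<omega> * h / 2)"
  have sin: "sin (of_int \<omega> * h) = 2 * s * c"
    using sin_double[of "of_int \<omega> * h / 2"] by (simp add: s_def c_def)
  have "c\<^sup>2 \<le> 1" by (simp add: c_def abs_square_le_1)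
  have ta: "\<tau> * a\<^sup>2 \<le> 2 * d" using assms by (simp add: field_simps)
  \<comment> \<open>Grouped to isolate \<tau> a^2, which the time-step constraint bounds by 2d. With
    c^2 \<le> 1 this leaves exactly 2x, the bound that \<open>norm_growth_le_1\<close>
    requires.\<close>
  have "(\<tau> * (a * sin (of_int \<omega> * h) / h))\<^sup>2 = \<tau> * (4 * s\<^sup>2 / h\<^sup>2) * (\<tau> * a\<^sup>2) * c\<^sup>2"
    unfolding sin by (simp add: power2_eq_square)
  also have "\<dots> \<le> \<tau> * (4 * s\<^sup>2 / h\<^sup>2) * (2 * d) * 1"
    using ta \<open>c\<^sup>2 \<le> 1\<close> assms by (intro mult_mono[where c = "c\<^sup>2"] mult_left_mono) auto
  finally show "cmod (exp (of_real (- (\<tau> * (4 * d * (sin (of_int \<omega> * h / 2))\<^sup>2 / h\<^sup>2))))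
       - \<i> * of_real (\<tau> * (a * sin (of_int \<omega> * h) / h))
         * phi1 (of_real (- (\<tau> * (4 * d * (sin (of_int \<omega> * h / 2))\<^sup>2 / h\<^sup>2))))) \<le> 1"
    using assms by (intro norm_growth_le_1) (auto simp: s_def mult_ac)
qed

end
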